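(* Let $\mathbf{n}=(n_1,\ldots,n_d)\in\mathbb{N}^d$ have pairwise relatively prime entries, let $\boldsymbol{\kappa}\in\mathbb{Z}^d$, and let $g\in\{1,\ldots,d\}$ be such that $n_i$ is odd for all $i\in\{1,\ldots,d\}\setminus\{g\}$. The affine Chebyshev variety $\mathcal{C}^{(2\mathbf{n})}_{\boldsymbol{\kappa}}$ can be written as $$\mathcal{C}^{(2\mathbf{n})}_{\boldsymbol{\kappa}}=\bigcup_{\mathbf{u}\in\{-1,1\}^d}\ell^{(2\mathbf{n})}_{\boldsymbol{\kappa},\mathbf{u}}([0,\pi))=\bigcup_{\substack{\mathbf{u}\in\{-1,1\}^d:\\ u_g=1}}\ell^{(2\mathbf{n})}_{\boldsymbol{\kappa},\mathbf{u}}([0,2\pi)).$$ A point $\mathbf{x}\in\mathcal{C}^{(2\mathbf{n})}_{\boldsymbol{\kappa}}$ is a singular point of $\mathcal{C}^{(2\mathbf{n})}_{\boldsymbol{\kappa}}$ if and only if it is an element of $\mathrm{LC}^{(2\mathbf{n})}_{\boldsymbol{\kappa},M}$ for some $M\subseteq\{1,\ldots,d\}$ with $\#M\geq 2$. Furthermore, for all $M\subseteq\{1,\ldots,d\}$ and $\mathfrak{r}\in\{0,1\}$ we have $$\mathrm{LC}^{(2\mathbf{n})}_{\boldsymbol{\kappa},M,\mathfrak{r}}=\bigl\{\mathbf{x}\in F^d_M\ \big|\ (-1)^{\kappa_1}T_{2n_1}(x_1)=\cdots=(-1)^{\kappa_d}T_{2n_d}(x_d)=(-1)^{\mathfrak{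r}}\bigr\}.$$
   Context: $\mathbb{N}=\{1,2,\ldots\}$, $\mathbb{N}_0=\mathbb{N}\cup\{0\}$, $d\in\mathbb{N}$, $p_i[\mathbf{n}]=\prod_{j\ne i}n_j$. $T_\gamma(x)=\cos(\gamma\arccos x)$, $x\in[-1,1]$. The variety is $\mathcal{C}^{(2\mathbf{n})}_{\boldsymbol{\kappa}}=\{\mathbf{x}\in[-1,1]^d\mid(-1)^{\kappa_1}T_{2n_1}(x_1)=\cdots=(-1)^{\kappa_d}T_{2n_d}(x_d)\}$. A point $\mathbf{x}^*$ of it is called singular if the Jacobian matrix at $\mathbf{x}^*$ of $(f_1,\ldots,f_{d-1})$, where $f_i(\mathbf{x})=(-1)^{\kappa_i}T_{2n_i}(x_i)-(-1)^{\kappa_{i+1}}T_{2n_{i+1}}(x_{i+1})$, does not have full rank $d-1$. For $\mathbf{u}\in\{-1,1\}^d$, $\ell^{(2\mathbf{n})}_{\boldsymbol{\kappa},\mathbf{u}}:\mathbb{R}\to[-1,1]^d$ is the curve whose $i$-th component is $u_i\cos\bigl(p_i[\mathbf{n}]\,t-\frac{\kappa_i\pi}{2n_i}\bigr)$. For $\mathfrak{r}\in\{0,1\}$ let $I^{(2\mathbf{n})}_{\boldsymbol{\kappa},\mathfrak{r}}$ be the set of all $\mathbf{i}\in\mathbb{N}_0^d$ with $0\le i_j\le 2n_j$ and $i_j\equiv\kappa_j+\mathfrak{r}\bmod 2$ for all $j$. For $M\subseteq\{1,\ldots,d\}$ let $I^{(2\mathbf{n})}_{\boldsymbol{\kappa},M,\mathfrak{r}}$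 be the set of those $\mathbf{i}\in I^{(2\mathbf{n})}_{\boldsymbol{\kappa},\mathfrak{r}}$ such that for each $j$: $0<i_j<2n_j\Leftrightarrow j\in M$. With $\mathbf{z}^{(2\mathbf{n})}_{\mathbf{i}}=(\cos(i_1\pi/(2n_1)),\ldots,\cos(i_d\pi/(2n_d)))$, put $\mathrm{LC}^{(2\mathbf{n})}_{\boldsymbol{\kappa},M,\mathfrak{r}}=\{\mathbf{z}^{(2\mathbf{n})}_{\mathbf{i}}\mid\mathbf{i}\in I^{(2\mathbf{n})}_{\boldsymbol{\kappa},M,\mathfrak{r}}\}$ and $\mathrm{LC}^{(2\mathbf{n})}_{\boldsymbol{\kappa},M}=\mathrm{LC}^{(2\mathbf{n})}_{\boldsymbol{\kappa},M,0}\cup\mathrm{LC}^{(2\mathbf{n})}_{\boldsymbol{\kappa},M,1}$. $F^d_M$ is the set of all $\mathbf{x}\in[-1,1]^d$ with $x_i\in(-1,1)$ for $i\in M$ and $x_i\in\{-1,1\}$ for $i\notin M$. *)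

theory Defs
  imports
    "HOL-Analysis.Derivative"
    "HOL-Number_Theory.Cong"
    "Jordan_Normal_Form.DL_Rank"
begin

text \<open>
  Points of d-dimensional real space are the functions in \<open>{1..d} \<rightarrow>\<^sub>E UNIV\<close>, so that equality of
  points is equality of functions. The parameters \<open>n\<close> and \<open>\<kappa>\<close> are read only at indices in
  \<open>{1..d}\<close>. All objects with the superscript (2n) take \<open>n\<close> as argument; the factor 2 is
  part of their definition.
\<close>

definition cube :: "nat \<Rightarrow> (nat \<Rightarrow> real) set" where
  "cube d = {1..d} \<rightarrow>\<^sub>E {-1..1}"

text \<open>Only meaningful for \<open>x \<in> {-1..1}\<close>, where \<open>arccos\<close> is specified.\<close>

definition cheb_T :: "real \<Rightarrow> real \<Rightarrow> real" where
  "cheb_T \<gamma> x = cos (\<gamma> * arccos x)"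

definition signed_T :: "(nat \<Rightarrow> nat) \<Rightarrow> (nat \<Rightarrow> int) \<Rightarrow> nat \<Rightarrow> real \<Rightarrow> real" where
  "signed_T n \<kappa> i y = (-1) powi (\<kappa> i) * cheb_T (real (2 * n i)) y"

definition cheb_variety :: "nat \<Rightarrow> (nat \<Rightarrow> nat) \<Rightarrow> (nat \<Rightarrow> int) \<Rightarrow> (nat \<Rightarrow> real) set" where
  "cheb_variety d n \<kappa> =
     {x \<in> cube d. \<forall>i\<in>{1..d}. \<forall>j\<in>{1..d}. signed_T n \<kappa> i (x i) = signed_T n \<kappa> j (x j)}"

definition variety_eq :: "(nat \<Rightarrow> nat) \<Rightarrow> (nat \<Rightarrow> int) \<Rightarrow> nat \<Rightarrow> (nat \<Rightarrow> real) \<Rightarrow> real" where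
  "variety_eq n \<kappa> i x = signed_T n \<kappa> i (x i) - signed_T n \<kappa> (i + 1) (x (i + 1))"

text \<open>
  The functions live on \<open>cube d\<close>, so a partial derivative is taken within \<open>{-1..1}\<close>. It is
  one-sided where \<open>x j = 1\<close> or \<open>x j = -1\<close>, and there too it equals the derivative of the
  Chebyshev polynomial that \<open>cheb_T\<close> with an even natural number as first argument represents
  on \<open>{-1..1}\<close>.
\<close>

definition partial_deriv :: "((nat \<Rightarrow> real) \<Rightarrow> real) \<Rightarrow> nat \<Rightarrow> (nat \<Rightarrow> real) \<Rightarrow> real" where
  "partial_deriv f j x = vector_derivative (\<lambda>t. f (x(j := t))) (at (x j) within {-1..1})"

text \<open>Matrix entries are indexed from 0, hence the shifts.\<close>

definition jacobian :: "nat \<Rightarrow> (nat \<Rightarrow> nat) \<Rightarrow> (nat \<Rightarrow> int) \<Rightarrow> (nat \<Rightarrow> real) \<Rightarrow> real mat" where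
  "jacobian d n \<kappa> x =
     mat (d - 1) d (\<lambda>(i, j). partial_deriv (variety_eq n \<kappa> (i + 1)) (j + 1) x)"

text \<open>The first argument of \<open>vec_space.rank\<close> is the number of rows of the matrix.\<close>

definition singular_point :: "nat \<Rightarrow> (nat \<Rightarrow> nat) \<Rightarrow> (nat \<Rightarrow> int) \<Rightarrow> (nat \<Rightarrow> real) \<Rightarrow> bool" where
  "singular_point d n \<kappa> x \<longleftrightarrow>
     x \<in> cheb_variety d n \<kappa> \<and> vec_space.rank (d - 1) (jacobian d n \<kappa> x) \<noteq> d - 1"

definition prod_except :: "nat \<Rightarrow> (nat \<Rightarrow> nat) \<Rightarrow> nat \<Rightarrow> nat" where
  "prod_except d n i = (\<Prod>j\<in>{1..d} - {i}. n j)"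

definition lissajous ::
  "nat \<Rightarrow> (nat \<Rightarrow> nat) \<Rightarrow> (nat \<Rightarrow> int) \<Rightarrow> (nat \<Rightarrow> real) \<Rightarrow> real \<Rightarrow> (nat \<Rightarrow> real)" where
  "lissajous d n \<kappa> u t =
     (\<lambda>i\<in>{1..d}. u i * cos (real (prod_except d n i) * t - of_int (\<kappa> i) * pi / (2 * real (n i))))"

definition sign_vectors :: "nat \<Rightarrow> (nat \<Rightarrow> real) set" where
  "sign_vectors d = {1..d} \<rightarrow>\<^sub>E {-1, 1}"

definition LC_index :: "nat \<Rightarrow> (nat \<Rightarrow> nat) \<Rightarrow> (nat \<Rightarrow> int) \<Rightarrow> nat \<Rightarrow> (nat \<Rightarrow> nat) set" where
  "LC_index d n \<kappa> r =
     {i \<in> {1..d} \<rightarrow>\<^sub>E UNIV. \<forall>j\<in>{1..d}. i j \<le> 2 * n j \<and> [int (i j) = \<kappa> j + int r] (mod 2)}"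

definition LC_index_on ::
  "nat \<Rightarrow> (nat \<Rightarrow> nat) \<Rightarrow> (nat \<Rightarrow> int) \<Rightarrow> nat set \<Rightarrow> nat \<Rightarrow> (nat \<Rightarrow> nat) set" where
  "LC_index_on d n \<kappa> M r =
     {i \<in> LC_index d n \<kappa> r. \<forall>j\<in>{1..d}. (0 < i j \<and> i j < 2 * n j) \<longleftrightarrow> j \<in> M}"

definition LC_point :: "nat \<Rightarrow> (nat \<Rightarrow> nat) \<Rightarrow> (nat \<Rightarrow> nat) \<Rightarrow> (nat \<Rightarrow> real)" where
  "LC_point d n i = (\<lambda>j\<in>{1..d}. cos (real (i j) * pi / (2 * real (n j))))"

definition LC_parity ::
  "nat \<Rightarrow> (nat \<Rightarrow> nat) \<Rightarrow> (nat \<Rightarrow> int) \<Rightarrow> nat set \<Rightarrow> nat \<Rightarrow> (nat \<Rightarrow> real) set" where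
  "LC_parity d n \<kappa> M r = LC_point d n ` LC_index_on d n \<kappa> M r"

definition LC :: "nat \<Rightarrow> (nat \<Rightarrow> nat) \<Rightarrow> (nat \<Rightarrow> int) \<Rightarrow> nat set \<Rightarrow> (nat \<Rightarrow> real) set" where
  "LC d n \<kappa> M = LC_parity d n \<kappa> M 0 \<union> LC_parity d n \<kappa> M 1"

definition face :: "nat \<Rightarrow> nat set \<Rightarrow> (nat \<Rightarrow> real) set" where
  "face d M =
     {x \<in> cube d. \<forall>i\<in>{1..d}. (i \<in> M \<longrightarrow> x i \<in> {-1<..<1}) \<and> (i \<notin> M \<longrightarrow> x i \<in> {-1, 1})}"

end

theory Submission
  imports Defs
begin

text \<open>
  Parametrise the coordinates as \<open>x i = cos (\<theta> i)\<close>, so that the equations of the variety read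
  \<open>cos (2 n\<^sub>i \<theta>\<^sub>i + \<kappa>\<^sub>i \<pi>) = c\<close> with a common value \<open>c = cos (2 P t)\<close>, where \<open>P\<close> is the product of
  all \<open>n\<^sub>i\<close>. Each \<open>\<theta>\<^sub>i\<close> is then known up to sign and up to a multiple \<open>h\<^sub>i \<pi> / n\<^sub>i\<close>. By the Chinese
  remainder theorem one shift of \<open>t\<close> by a multiple of \<open>\<pi> / P\<close> realises all \<open>h\<^sub>i\<close> at once up to
  multiples of \<open>\<pi>\<close>, which only change signs. A shift of \<open>t\<close> by \<open>\<pi>\<close> changes the sign of coordinate \<open>g\<close>,
  since the product of the other \<open>n\<^sub>i\<close> is odd.

  The Jacobian is bidiagonal: column \<open>j\<close> is a multiple of a fixed vector by the slope of
  \<open>T\<close> in coordinate \<open>j\<close>, and the rank drops exactly when two of these slopes vanish. By the Pell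
  identity \<open>T\<^sub>m\<^sup>2 + (1 - x\<^sup>2) U\<^sub>m\<^sub>-\<^sub>1\<^sup>2 = 1\<close> a slope vanishes exactly at interior points where \<open>T = \<plusminus>1\<close>.
\<close>

section \<open>Chebyshev polynomials\<close>

text \<open>
  The recursion is the addition theorem for \<open>cos\<close> and \<open>sin\<close>. The second polynomial is \<open>U\<^sub>m\<^sub>-\<^sub>1\<close>,
  with value 0 for \<open>m = 0\<close>.
\<close>

fun cheb_poly :: "nat \<Rightarrow> real \<Rightarrow> real" and cheb_poly2 :: "nat \<Rightarrow> real \<Rightarrow> real" where
  "cheb_poly 0 x = 1"
| "cheb_poly (Suc m) x = x * cheb_poly m x - (1 - x\<^sup>2) * cheb_poly2 m x"
| "cheb_poly2 0 x = 0"
| "cheb_poly2 (Suc m) x = x * cheb_poly2 m x + cheb_poly m x"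

lemma cheb_poly_cos_sin:
  "cheb_poly m (cos t) = cos (real m * t) \<and> cheb_poly2 m (cos t) * sin t = sin (real m * t)"
proof (induction m)
  case (Suc m)
  have "cheb_poly (Suc m) (cos t) = cos t * cheb_poly m (cos t) - sin t * (cheb_poly2 m (cos t) * sin t)"
    unfolding cheb_poly.simps sin_squared_eq[symmetric] by (simp add: power2_eq_square)
  moreover have "cheb_poly2 (Suc m) (cos t) * sin t
      = cos t * (cheb_poly2 m (cos t) * sin t) + cheb_poly m (cos t) * sin t"
    by (simp add: algebra_simps)
  ultimately show ?case
    using Suc by (simp add: distrib_right cos_add sin_add algebra_simps)
qed simp

text \<open>With \<open>s^2 = 1 - x^2\<close>, the recursion multiplies
  \<open>cheb_poly m x + i s * cheb_poly2 m x\<close> by \<open>x + i s\<close>. The form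
  \<open>a^2 + s^2 b^2\<close> of \<open>a + i s b\<close> is multiplicative, and the factor has
  value 1.\<close>

lemma cheb_poly_pell: "(cheb_poly m x)\<^sup>2 + (1 - x\<^sup>2) * (cheb_poly2 m x)\<^sup>2 = 1"
proof (induction m)
  case (Suc m)
  have "(cheb_poly (Suc m) x)\<^sup>2 + (1 - x\<^sup>2) * (cheb_poly2 (Suc m) x)\<^sup>2 =
      (x\<^sup>2 + (1 - x\<^sup>2)) * ((cheb_poly m x)\<^sup>2 + (1 - x\<^sup>2) * (cheb_poly2 m x)\<^sup>2)"
    by (simp add: power2_eq_square algebra_simps)
  with Suc show ?case by simp
qed simp

text \<open>
  The derivative \<open>D\<close> of the second polynomial occurs only in the combination \<open>(1 - x\<^sup>2) * D\<close>, which
  keeps the induction free of a division by zero at \<open>x = \<plusminus>1\<close>.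
\<close>

lemma cheb_poly_derivs:
  "(cheb_poly m has_real_derivative real m * cheb_poly2 m x) (at x) \<and>
   (\<exists>D. (cheb_poly2 m has_real_derivative D) (at x) \<and>
      (1 - x\<^sup>2) * D = x * cheb_poly2 m x - real m * cheb_poly m x)"
proof (induction m)
  case 0
  have "cheb_poly 0 = (\<lambda>x. 1)" "cheb_poly2 0 = (\<lambda>x. 0)" by auto
  then show ?case by (auto intro!: exI[of _ 0])
next
  case (Suc m)
  then obtain D where P: "(cheb_poly m has_real_derivative real m * cheb_poly2 m x) (at x)"
    and Q: "(cheb_poly2 m has_real_derivative D) (at x)"
    and D: "(1 - x\<^sup>2) * D = x * cheb_poly2 m x - real m * cheb_poly m x"
    by blast
  have P_Suc: "cheb_poly (Suc m) = (\<lambda>x. x * cheb_poly m x - (1 - x\<^sup>2) * cheb_poly2 m x)"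
    and Q_Suc: "cheb_poly2 (Suc m) = (\<lambda>x. x * cheb_poly2 m x + cheb_poly m x)"
    by auto
  have "(cheb_poly (Suc m) has_real_derivative
      cheb_poly m x + x * (real m * cheb_poly2 m x) + 2 * x * cheb_poly2 m x - (1 - x\<^sup>2) * D) (at x)"
    unfolding P_Suc by (rule derivative_eq_intros P Q refl | simp)+
  moreover have "cheb_poly m x + x * (real m * cheb_poly2 m x) + 2 * x * cheb_poly2 m x - (1 - x\<^sup>2) * D
      = real (Suc m) * cheb_poly2 (Suc m) x"
    unfolding D by (simp add: algebra_simps)
  moreover have "(cheb_poly2 (Suc m) has_real_derivative
      cheb_poly2 m x + x * D + real m * cheb_poly2 m x) (at x)"
    unfolding Q_Suc by (rule derivative_eq_intros P Q refl | simp)+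
  moreover have "(1 - x\<^sup>2) * (cheb_poly2 m x + x * D + real m * cheb_poly2 m x)
      = x * cheb_poly2 (Suc m) x - real (Suc m) * cheb_poly (Suc m) x"
  proof -
    have "(1 - x\<^sup>2) * (cheb_poly2 m x + x * D + real m * cheb_poly2 m x)
      = (1 - x\<^sup>2) * (1 + real m) * cheb_poly2 m x + x * ((1 - x\<^sup>2) * D)"
      by (simp add: algebra_simps)
    then show ?thesis unfolding D by (simp add: power2_eq_square algebra_simps)
  qed
  ultimately show ?case by metis
qed

text \<open>At \<plusminus>1 the factor \<open>1 - x^2\<close> in the Pell identity vanishes, so
  these values are computed separately; they show that \<open>cheb_poly2\<close> is nonzero there
  for \<open>m > 0\<close>.\<close>

lemma cheb_poly2_at_pm1:
  "cheb_poly m 1 = 1 \<and> cheb_poly2 m 1 = real m"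
  "cheb_poly m (-1) = (-1) ^ m \<and> cheb_poly2 m (-1) = - ((-1) ^ m * real m)"
  by (induction m) (auto simp: algebra_simps)

lemma cheb_poly2_eq_0_iff:
  assumes "m > 0" "x \<in> {-1..1}"
  shows "cheb_poly2 m x = 0 \<longleftrightarrow> x \<in> {-1<..<1} \<and> \<bar>cheb_poly m x\<bar> = 1"
proof (cases "x = 1 \<or> x = -1")
  case True
  then show ?thesis using cheb_poly2_at_pm1[of m] assms by auto
next
  case False
  then have x: "x \<in> {-1<..<1}" using assms by auto
  then have "x\<^sup>2 < 1" using abs_square_less_1[of x] by auto
  moreover have "\<bar>cheb_poly m x\<bar> = 1 \<longleftrightarrow> (cheb_poly m x)\<^sup>2 = 1"
    by (metis abs_square_eq_1)
  ultimately show ?thesis using x cheb_poly_pell[of m x] by auto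
qed

text \<open>Replaces \<open>arccos\<close>, which is not differentiable at \<plusminus>1, by a
  polynomial, so that one-sided derivatives are restrictions of ordinary ones.\<close>

lemma cheb_T_eq_cheb_poly: "x \<in> {-1..1} \<Longrightarrow> cheb_T (real m) x = cheb_poly m x"
  using cheb_poly_cos_sin[of m "arccos x"] by (simp add: cheb_T_def cos_arccos)

text \<open>Valid for every real \<open>t\<close>, although \<open>arccos (cos t)\<close> is
  \<open>t\<close> only on \<open>{0..pi}\<close>: the polynomial sees just
  \<open>cos t\<close>.\<close>

lemma cheb_T_cos: "cheb_T (real m) (cos t) = cos (real m * t)"
  using cheb_T_eq_cheb_poly[of "cos t" m] cheb_poly_cos_sin[of m t] by simp

section \<open>Signed Chebyshev functions and their slopes\<close>

lemma abs_minus_one_powi [simp]: "\<bar>(-1) powi k\<bar> = (1::real)"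
  by (simp add: power_int_abs)

lemma cos_add_int_pi: "cos (t + of_int k * pi) = (-1) powi k * cos t"
  by (simp add: cos_add power_int_minus_left sin_times_pi_eq_0 cos_npi_int mult.commute[of "of_int k"])

lemma signed_T_cos: "signed_T n \<kappa> i (cos t) = cos (2 * real (n i) * t + of_int (\<kappa> i) * pi)"
  by (simp only: signed_T_def cheb_T_cos cos_add_int_pi) (simp add: mult.assoc)

lemma abs_signed_T_le_1: "\<bar>signed_T n \<kappa> i y\<bar> \<le> 1"
  by (simp add: signed_T_def cheb_T_def abs_mult)

text \<open>The signed derivative \<open>T\<^sub>m' = m * U\<^sub>m\<^sub>-\<^sub>1\<close> for
  \<open>m = 2 * n i\<close>, in a polynomial form that makes sense at \<plusminus>1 too.\<close>

definition signed_T_slope :: "(nat \<Rightarrow> nat) \<Rightarrow> (nat \<Rightarrow> int) \<Rightarrow> nat \<Rightarrow> real \<Rightarrow> real" where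
  "signed_T_slope n \<kappa> i y = (-1) powi (\<kappa> i) * (real (2 * n i) * cheb_poly2 (2 * n i) y)"

lemma has_vector_derivative_signed_T:
  assumes "y \<in> {-1..1}"
  shows "(signed_T n \<kappa> i has_vector_derivative signed_T_slope n \<kappa> i y) (at y within {-1..1})"
proof -
  have "((\<lambda>y. (-1) powi (\<kappa> i) * cheb_poly (2 * n i) y) has_real_derivative signed_T_slope n \<kappa> i y)
      (at y within {-1..1})"
    unfolding signed_T_slope_def
    using cheb_poly_derivs[of "2 * n i" y] by (intro DERIV_cmult) (auto intro: DERIV_subset)
  then have "((\<lambda>y. (-1) powi (\<kappa> i) * cheb_poly (2 * n i) y) has_vector_derivative signed_T_slope n \<kappa> i y)
      (at y within {-1..1})"
    by (rule has_real_derivative_iff_has_vector_derivative[THEN iffD1])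
  then show ?thesis
    by (rule has_vector_derivative_transform[OF assms, rotated])
      (simp only: signed_T_def cheb_T_eq_cheb_poly)
qed

lemma signed_T_slope_eq_0_iff:
  assumes "n i \<ge> 1" "y \<in> {-1..1}"
  shows "signed_T_slope n \<kappa> i y = 0 \<longleftrightarrow> y \<in> {-1<..<1} \<and> \<bar>signed_T n \<kappa> i y\<bar> = 1"
proof -
  have "signed_T_slope n \<kappa> i y = 0 \<longleftrightarrow> cheb_poly2 (2 * n i) y = 0"
    using assms by (simp add: signed_T_slope_def)
  moreover have "\<bar>signed_T n \<kappa> i y\<bar> = \<bar>cheb_poly (2 * n i) y\<bar>"
    unfolding signed_T_def cheb_T_eq_cheb_poly[OF assms(2)] abs_mult by simp
  ultimately show ?thesis using cheb_poly2_eq_0_iff[of "2 * n i" y] assms by simp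
qed

section \<open>The rank of a bidiagonal matrix\<close>

text \<open>The rank is the dimension of the column span. A maximal independent set of
  \<open>n\<close> columns is a basis, so full rank means that the columns span the whole space,
  i.e. that every system with matrix \<open>A\<close> is solvable.\<close>

lemma (in vec_space) full_row_rank_iff:
  assumes A: "A \<in> carrier_mat n nc"
  shows "rank A = n \<longleftrightarrow> (\<forall>y\<in>carrier_vec n. \<exists>w\<in>carrier_vec nc. A *\<^sub>v w = y)"
proof -
  have C: "set (cols A) \<subseteq> carrier_vec n" using A cols_dim by blast
  have "rank A = n \<longleftrightarrow> span (set (cols A)) = carrier_vec n"
  proof
    assume rank: "rank A = n"
    obtain S where S: "maximal S (\<lambda>T. T \<subseteq> set (cols A) \<and> lin_indpt T)"
      using maximal_exists_superset[of "set (cols A)" "\<lambda>T. T \<subseteq> set (cols A) \<and> lin_indpt T" "{}"]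
      by (auto simp: finite_lin_indpt2)
    then have "S \<subseteq> set (cols A)" "lin_indpt S" by (auto simp: maximal_def)
    moreover have "card S = n" using rank_card_indpt[OF A S] rank by simp
    ultimately have "basis S"
      using C by (intro dim_li_is_basis) (auto simp: dim_is_n intro: finite_subset)
    then have "span S = carrier_vec n" by (simp add: basis_def)
    moreover have "span S \<subseteq> span (set (cols A))"
      by (rule span_is_monotone) fact
    ultimately show "span (set (cols A)) = carrier_vec n"
      using span_closed[OF C] by auto
  next
    assume "span (set (cols A)) = carrier_vec n"
    then show "rank A = n"
      using dim_is_n by (simp add: rank_def module_vec_def)
  qed
  also have "\<dots> \<longleftrightarrow> (\<forall>y\<in>carrier_vec n. \<exists>w\<in>carrier_vec nc. A *\<^sub>v w = y)"
    using col_space_eq[OF A] A unfolding col_space_def by auto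
  finally show ?thesis .
qed

lemma rank_bidiagonal:
  fixes a :: "nat \<Rightarrow> 'a :: field" and d :: nat
  defines "B \<equiv> mat (d - 1) d (\<lambda>(i, j). if j = i then a j else if j = Suc i then - a j else 0)"
  shows "vec_space.rank (d - 1) B \<noteq> d - 1 \<longleftrightarrow> (\<exists>p q. p < q \<and> q < d \<and> a p = 0 \<and> a q = 0)"
    (is "?deficient \<longleftrightarrow> ?zeros")
proof -
  interpret vec_space "TYPE('a)" "d - 1" .
  have B: "B \<in> carrier_mat (d - 1) d" by (simp add: B_def)
  \<comment> \<open>The vector \<open>w\<close> enters only through the products
    \<open>a j * w $ j\<close>, and each row is the difference of two consecutive ones.\<close>
  have row: "(B *\<^sub>v w) $ i = a i * w $ i - a (Suc i) * w $ Suc i"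
    if "i < d - 1" "w \<in> carrier_vec d" for i w
  proof -
    have "(B *\<^sub>v w) $ i = (\<Sum>j<d. (if j = i then a j * w $ j else 0) - (if j = Suc i then a j * w $ j else 0))"
      using that by (auto simp: B_def scalar_prod_def lessThan_atLeast0 intro!: sum.cong)
    also have "\<dots> = a i * w $ i - a (Suc i) * w $ Suc i"
      using that by (auto simp: sum_subtractf)
    finally show ?thesis .
  qed
  show ?thesis
  proof
    assume ?zeros
    then obtain p q where pq: "p < q" "q < d" "a p = 0" "a q = 0" by blast
    \<comment> \<open>The rows with indices in \<open>{p..<q}\<close> sum to zero: the sum telescopes to multiples of
      \<open>a p\<close> and \<open>a q\<close>.\<close>
    have telescope: "(\<Sum>i\<in>{p..<q}. (B *\<^sub>v w) $ i) = 0" if "w \<in> carrier_vec d" for w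
    proof -
      have "(\<Sum>i\<in>{p..<q}. (B *\<^sub>v w) $ i) = (\<Sum>i\<in>{p..<q}. a i * w $ i - a (Suc i) * w $ Suc i)"
        using pq that by (intro sum.cong) (auto simp: row)
      also have "\<dots> = - (\<Sum>i\<in>{p..<q}. a (Suc i) * w $ Suc i - a i * w $ i)"
        by (simp add: sum_negf[symmetric])
      also have "\<dots> = 0"
        using sum_Suc_diff'[of p q "\<lambda>i. a i * w $ i"] pq by simp
      finally show ?thesis .
    qed
    show ?deficient
    proof
      assume "rank B = d - 1"
      \<comment> \<open>The entries of the unit vector at \<open>p\<close> over
        \<open>{p..<q}\<close> sum to 1, so it cannot lie in the image.\<close>
      then obtain w where "w \<in> carrier_vec d" "B *\<^sub>v w = unit_vec (d - 1) p"
        using full_row_rank_iff[OF B] by (metis unit_vec_carrier)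
      moreover have "(\<Sum>i\<in>{p..<q}. unit_vec (d - 1) p $ i) = (\<Sum>i\<in>{p..<q}. if i = p then 1 else (0::'a))"
        using pq by (intro sum.cong) auto
      ultimately show False using telescope[of w] pq by simp
    qed
  next
    assume ?deficient
    show ?zeros
    proof (rule ccontr)
      assume no_zeros: "\<not> ?zeros"
      \<comment> \<open>\<open>m\<close> is the zero of \<open>a\<close> below \<open>d\<close> if
        there is one, and arbitrary otherwise.\<close>
      obtain m where m: "\<And>j. j < d \<Longrightarrow> j \<noteq> m \<Longrightarrow> a j \<noteq> 0"
        using no_zeros by (metis linorder_neqE_nat)
      \<comment> \<open>\<open>b\<close> solves \<open>b i - b (Suc i) = y $ i\<close>, normalised by \<open>b m = 0\<close>, so that
        \<open>b m / a m = 0\<close> even if \<open>a m = 0\<close>.\<close>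
      have "\<exists>w\<in>carrier_vec d. B *\<^sub>v w = y" if y: "y \<in> carrier_vec (d - 1)" for y
      proof -
        define b where "b j = (\<Sum>i<m. y $ i) - (\<Sum>i<j. y $ i)" for j
        define w where "w = vec d (\<lambda>j. b j / a j)"
        have w: "w \<in> carrier_vec d" by (simp add: w_def)
        have aw: "a j * w $ j = b j" if "j < d" for j
          using m[OF that] that by (cases "j = m") (auto simp: w_def b_def)
        have "B *\<^sub>v w = y"
        proof (rule eq_vecI)
          fix i assume "i < dim_vec y"
          with y have i: "i < d - 1" by simp
          then have "(B *\<^sub>v w) $ i = b i - b (Suc i)"
            using aw w by (simp add: row)
          then show "(B *\<^sub>v w) $ i = y $ i" by (simp add: b_def)
        qed (use y B in simp)
        with w show ?thesis by blast
      qed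
      then show False using \<open>?deficient\<close> full_row_rank_iff[OF B] by blast
    qed
  qed
qed

section \<open>Lissajous curves\<close>

lemma cos_eq_cosD:
  fixes x y :: real
  assumes "cos x = cos y"
  shows "\<exists>k::int. x = y + 2 * pi * of_int k \<or> - x = y + 2 * pi * of_int k"
proof -
  have "sin ((x + y) / 2) = 0 \<or> sin ((y - x) / 2) = 0"
    using cos_diff_cos[of x y] assms by simp
  then obtain i :: int where "(x + y) / 2 = of_int i * pi \<or> (y - x) / 2 = of_int i * pi"
    unfolding sin_zero_iff_int2 by blast
  then have "x = y + 2 * pi * of_int (-i) \<or> - x = y + 2 * pi * of_int (-i)"
    by (auto simp: field_simps)
  then show ?thesis by blast
qed

lemma minus_one_powi_in: "(-1) powi k \<in> {-1, 1::real}"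
  by (simp add: power_int_minus_left)

lemma chinese_remainder_int_dvd:
  fixes m :: "'a \<Rightarrow> nat" and h :: "'a \<Rightarrow> int"
  assumes "finite A" "\<And>i. i \<in> A \<Longrightarrow> m i \<ge> 1"
    and "\<forall>i\<in>A. \<forall>j\<in>A. i \<noteq> j \<longrightarrow> coprime (m i) (m j)"
  shows "\<exists>x. \<forall>i\<in>A. int (m i) dvd int x - h i"
proof -
  obtain x where x: "\<forall>i\<in>A. [x = nat (h i mod int (m i))] (mod m i)"
    using chinese_remainder_nat[OF assms(1,3), of "\<lambda>i. nat (h i mod int (m i))"] by blast
  have "int (m i) dvd int x - h i" if "i \<in> A" for i
  proof -
    have "[int x = int (nat (h i mod int (m i)))] (mod int (m i))"
      using x that cong_int_iff by blast
    moreover have "int (nat (h i mod int (m i))) = h i mod int (m i)"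
      using assms(2)[OF that] by simp
    ultimately have "[int x = h i] (mod int (m i))"
      by (simp add: cong_def)
    then show ?thesis by (simp add: cong_iff_dvd_diff)
  qed
  then show ?thesis by blast
qed

text \<open>The shift adds \<open>prod_except d n i * k\<close> half turns to phase
  \<open>i\<close>, hence only signs change. The restriction to \<open>{1..d}\<close> keeps the new
  sign vector extensional.\<close>

lemma lissajous_shift:
  "lissajous d n \<kappa> u (t + of_int k * pi)
    = lissajous d n \<kappa> (\<lambda>i\<in>{1..d}. u i * (-1) powi (int (prod_except d n i) * k)) t"
proof
  fix i
  show "lissajous d n \<kappa> u (t + of_int k * pi) i
    = lissajous d n \<kappa> (\<lambda>i\<in>{1..d}. u i * (-1) powi (int (prod_except d n i) * k)) t i"
  proof (cases "i \<in> {1..d}")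
    case True
    let ?p = "prod_except d n i"
    have "real ?p * (t + of_int k * pi) - of_int (\<kappa> i) * pi / (2 * real (n i))
      = (real ?p * t - of_int (\<kappa> i) * pi / (2 * real (n i))) + of_int (int ?p * k) * pi"
      by (simp add: algebra_simps)
    with True show ?thesis
      unfolding lissajous_def by (simp only: cos_add_int_pi restrict_apply if_True mult.assoc)
  qed (auto simp: lissajous_def)
qed

lemma sign_vectors_shift:
  "u \<in> sign_vectors d \<Longrightarrow> (\<lambda>i\<in>{1..d}. u i * (-1) powi e i) \<in> sign_vectors d"
proof -
  assume u: "u \<in> sign_vectors d"
  have "u i * (-1) powi e i \<in> {-1, 1}" if "i \<in> {1..d}" for i
  proof -
    have "u i \<in> {-1, 1}" using u that unfolding sign_vectors_def by blast
    then show ?thesis using minus_one_powi_in[of "e i"] by auto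
  qed
  then show ?thesis unfolding sign_vectors_def by auto
qed

lemma prod_except_times: "i \<in> {1..d} \<Longrightarrow> prod_except d n i * n i = (\<Prod>j\<in>{1..d}. n j)"
  by (simp add: prod_except_def prod.remove mult.commute)

text \<open>Multiplying phase \<open>i\<close> by \<open>2 * n i\<close> cancels the \<kappa> terms
  and leaves the frequency \<open>2 * P\<close>, the same for all \<open>i\<close>. A sign
  \<open>u i = -1\<close> is a shift by \<open>pi\<close>, which becomes \<open>n i\<close> full
  turns.\<close>

lemma lissajous_in_cheb_variety:
  assumes n: "\<forall>i\<in>{1..d}. n i \<ge> 1" and u: "u \<in> sign_vectors d"
  shows "lissajous d n \<kappa> u t \<in> cheb_variety d n \<kappa>"
proof -
  define P where "P = (\<Prod>j\<in>{1..d}. n j)"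
  have ui: "u i = 1 \<or> u i = -1" if "i \<in> {1..d}" for i
    using u that by (auto simp: sign_vectors_def PiE_iff)
  have "signed_T n \<kappa> i (lissajous d n \<kappa> u t i) = cos (2 * real P * t)" if i: "i \<in> {1..d}" for i
  proof -
    define \<phi> where "\<phi> = real (prod_except d n i) * t - of_int (\<kappa> i) * pi / (2 * real (n i))"
    have "\<exists>k::int. u i * cos \<phi> = cos (\<phi> + of_int k * pi)"
    proof (cases "u i = 1")
      case True
      then show ?thesis by (intro exI[of _ 0]) simp
    next
      case False
      then show ?thesis using ui[OF i] by (intro exI[of _ 1]) simp
    qed
    then obtain k :: int where k: "u i * cos \<phi> = cos (\<phi> + of_int k * pi)" by blast
    have "real (prod_except d n i) * real (n i) = real P"
      using prod_except_times[OF i, of n] unfolding P_def of_nat_mult[symmetric] by simp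
    moreover have "n i > 0" using n i by force
    ultimately have eq: "2 * real (n i) * (\<phi> + of_int k * pi) + of_int (\<kappa> i) * pi
        = 2 * real P * t + of_int (2 * int (n i) * k) * pi"
      by (simp add: \<phi>_def field_simps)
    have "lissajous d n \<kappa> u t i = cos (\<phi> + of_int k * pi)"
      using i k by (simp add: lissajous_def \<phi>_def)
    then have "signed_T n \<kappa> i (lissajous d n \<kappa> u t i) = cos (2 * real P * t + of_int (2 * int (n i) * k) * pi)"
      by (metis signed_T_cos eq)
    also have "\<dots> = (-1) powi (2 * int (n i) * k) * cos (2 * real P * t)"
      by (rule cos_add_int_pi)
    also have "\<dots> = cos (2 * real P * t)"
      by (simp add: power_int_minus_left)
    finally show ?thesis .
  qed
  moreover have "u i * cos s \<in> {-1..1}" if "i \<in> {1..d}" for i s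
    using ui[OF that] by auto
  then have "lissajous d n \<kappa> u t \<in> cube d"
    by (auto simp: lissajous_def cube_def PiE_iff simp del: atLeastAtMost_iff)
  ultimately show ?thesis by (auto simp: cheb_variety_def)
qed

lemma cheb_variety_imp_lissajous:
  assumes d: "d \<ge> 1" and n: "\<forall>i\<in>{1..d}. n i \<ge> 1"
    and coprime: "\<forall>i\<in>{1..d}. \<forall>j\<in>{1..d}. i \<noteq> j \<longrightarrow> coprime (n i) (n j)"
    and x: "x \<in> cheb_variety d n \<kappa>"
  shows "\<exists>u\<in>sign_vectors d. \<exists>t. x = lissajous d n \<kappa> u t"
proof -
  define P where "P = (\<Prod>j\<in>{1..d}. n j)"
  have n_pos: "n i > 0" if "i \<in> {1..d}" for i using n that by force
  then have P_pos: "P > 0" unfolding P_def by (intro prod_pos) blast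
  have x_cube: "x \<in> cube d" using x by (simp add: cheb_variety_def)
  have "\<forall>i\<in>{1..d}. \<forall>j\<in>{1..d}. signed_T n \<kappa> i (x i) = signed_T n \<kappa> j (x j)"
    using x unfolding cheb_variety_def by blast
  moreover have "1 \<in> {1..d}" using d by simp
  ultimately have eq: "\<And>i. i \<in> {1..d} \<Longrightarrow> signed_T n \<kappa> i (x i) = signed_T n \<kappa> 1 (x 1)"
    by blast
  \<comment> \<open>\<open>t0\<close> only reproduces the common value of the signed polynomials;
    the coordinates themselves are matched by a later shift.\<close>
  define t0 where "t0 = arccos (signed_T n \<kappa> 1 (x 1)) / (2 * real P)"
  have t0: "cos (2 * real P * t0) = signed_T n \<kappa> 1 (x 1)"
    using P_pos abs_signed_T_le_1[of n \<kappa> 1 "x 1"]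
    by (simp add: t0_def cos_arccos_abs)
  have "\<exists>\<phi> h. cos \<phi> = x i \<and> 2 * real (n i) * \<phi> = 2 * real P * t0 - of_int (\<kappa> i) * pi + 2 * pi * of_int h"
    if i: "i \<in> {1..d}" for i
  proof -
    define \<theta> where "\<theta> = arccos (x i)"
    have \<theta>: "cos \<theta> = x i" using x_cube i by (auto simp: \<theta>_def cube_def PiE_iff intro!: cos_arccos)
    have "cos (2 * real (n i) * \<theta> + of_int (\<kappa> i) * pi) = cos (2 * real P * t0)"
      using eq[OF i] t0 unfolding \<theta>[symmetric] signed_T_cos by simp
    then obtain k :: int where
      "2 * real (n i) * \<theta> + of_int (\<kappa> i) * pi = 2 * real P * t0 + 2 * pi * of_int k \<or>
       - (2 * real (n i) * \<theta> + of_int (\<kappa> i) * pi) = 2 * real P * t0 + 2 * pi * of_int k"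
      using cos_eq_cosD by blast
    then show ?thesis
    proof
      assume "2 * real (n i) * \<theta> + of_int (\<kappa> i) * pi = 2 * real P * t0 + 2 * pi * of_int k"
      with \<theta> show ?thesis by (intro exI[of _ \<theta>] exI[of _ k]) (simp add: algebra_simps)
    next
      assume "- (2 * real (n i) * \<theta> + of_int (\<kappa> i) * pi) = 2 * real P * t0 + 2 * pi * of_int k"
      \<comment> \<open>Passing to \<open>-\<theta>\<close> keeps the cosine but reverses the
        \<kappa> term; the extra \<open>\<kappa> i\<close> in the multiple of \<open>2 * pi\<close>
        restores it.\<close>
      with \<theta> show ?thesis by (intro exI[of _ "-\<theta>"] exI[of _ "k + \<kappa> i"]) (simp add: algebra_simps)
    qed
  qed
  then obtain \<phi> h where \<phi>: "\<And>i. i \<in> {1..d} \<Longrightarrow> cos (\<phi> i) = x i"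
    and h: "\<And>i. i \<in> {1..d} \<Longrightarrow>
      2 * real (n i) * \<phi> i = 2 * real P * t0 - of_int (\<kappa> i) * pi + 2 * pi * of_int (h i)"
    by metis
  obtain m where "\<forall>i\<in>{1..d}. int (n i) dvd int m - h i"
    using chinese_remainder_int_dvd[of "{1..d}" n h] n coprime by auto
  then obtain z where z: "\<And>i. i \<in> {1..d} \<Longrightarrow> int m - h i = int (n i) * z i"
    unfolding dvd_def by metis
  \<comment> \<open>Since \<open>prod_except d n i / P = 1 / n i\<close>, this shift adds
    \<open>m * pi / n i = h i * pi / n i + z i * pi\<close> to phase \<open>i\<close>. The first
    summand turns the phase into \<open>\<phi> i\<close>; the second is a sign, which
    \<open>u\<close> cancels.\<close>
  define t where "t = t0 + pi * real m / real P"
  define u where "u = (\<lambda>i\<in>{1..d}. (-1) powi z i :: real)"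
  have "x = lissajous d n \<kappa> u t"
  proof
    fix i
    show "x i = lissajous d n \<kappa> u t i"
    proof (cases "i \<in> {1..d}")
      case True
      let ?\<psi> = "real (prod_except d n i) * t - of_int (\<kappa> i) * pi / (2 * real (n i))"
      have n0: "real (n i) \<noteq> 0" using n_pos[OF True] by simp
      have m_eq: "real m = of_int (h i) + real (n i) * of_int (z i)"
        using arg_cong[OF z[OF True], of real_of_int] by simp
      have "real (prod_except d n i) * real (n i) = real P"
        using prod_except_times[OF True, of n] unfolding P_def of_nat_mult[symmetric] by simp
      then have p_eq: "real (prod_except d n i) = real P / real (n i)"
        using n0 by (simp add: eq_divide_eq)
      have "\<phi> i = (2 * real P * t0 - of_int (\<kappa> i) * pi + 2 * pi * of_int (h i)) / (2 * real (n i))"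
        using h[OF True] n0 by (simp add: eq_divide_eq mult.commute mult.left_commute)
      then have "?\<psi> = \<phi> i + of_int (z i) * pi"
        using n0 P_pos unfolding p_eq t_def m_eq by (simp add: divide_simps) (simp add: algebra_simps)
      then have "cos ?\<psi> = (-1) powi z i * x i"
        using \<phi>[OF True] cos_add_int_pi by simp
      then show ?thesis
        using True by (simp add: lissajous_def u_def power_int_minus_one_mult_self')
    next
      case False
      then show ?thesis using x_cube by (auto simp: lissajous_def cube_def PiE_iff extensional_def)
    qed
  qed
  moreover have "u \<in> sign_vectors d"
    unfolding u_def sign_vectors_def restrict_PiE_iff using minus_one_powi_in by blast
  ultimately show ?thesis by blast
qed

section \<open>Reduction of the parameter range\<close>

lemma cheb_variety_eq_lissajous:
  assumes "d \<ge> 1" and n: "\<forall>i\<in>{1..d}. n i \<ge> 1"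
    and "\<forall>i\<in>{1..d}. \<forall>j\<in>{1..d}. i \<noteq> j \<longrightarrow> coprime (n i) (n j)"
  shows "cheb_variety d n \<kappa> = (\<Union>u\<in>sign_vectors d. lissajous d n \<kappa> u ` {0..<pi})"
proof
  show "cheb_variety d n \<kappa> \<subseteq> (\<Union>u\<in>sign_vectors d. lissajous d n \<kappa> u ` {0..<pi})"
  proof
    fix x assume "x \<in> cheb_variety d n \<kappa>"
    then obtain u t where u: "u \<in> sign_vectors d" and x: "x = lissajous d n \<kappa> u t"
      using cheb_variety_imp_lissajous[OF assms] by blast
    define k where "k = \<lfloor>t / pi\<rfloor>"
    define s where "s = t - of_int k * pi"
    have "of_int k \<le> t / pi" "t / pi < of_int k + 1" unfolding k_def by linarith+
    then have "of_int k * pi \<le> t" "t < (of_int k + 1) * pi"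
      using pi_gt_zero by (simp_all add: pos_le_divide_eq pos_divide_less_eq)
    then have "s \<in> {0..<pi}"
      by (simp add: s_def algebra_simps)
    moreover define v where "v = (\<lambda>i\<in>{1..d}. u i * (-1) powi (int (prod_except d n i) * k))"
    have "x = lissajous d n \<kappa> v s"
      unfolding x v_def lissajous_shift[symmetric] by (simp add: s_def)
    moreover have "v \<in> sign_vectors d" unfolding v_def by (rule sign_vectors_shift[OF u])
    ultimately show "x \<in> (\<Union>u\<in>sign_vectors d. lissajous d n \<kappa> u ` {0..<pi})"
      by blast
  qed
qed (use lissajous_in_cheb_variety[OF n] in blast)

lemma cheb_variety_eq_lissajous_half:
  assumes "d \<ge> 1" and n: "\<forall>i\<in>{1..d}. n i \<ge> 1"
    and "\<forall>i\<in>{1..d}. \<forall>j\<in>{1..d}. i \<noteq> j \<longrightarrow> coprime (n i) (n j)"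
    and g: "g \<in> {1..d}" and odd_n: "\<forall>i\<in>{1..d} - {g}. odd (n i)"
  shows "cheb_variety d n \<kappa> =
    (\<Union>u\<in>{u \<in> sign_vectors d. u g = 1}. lissajous d n \<kappa> u ` {0..<2 * pi})"
proof
  show "cheb_variety d n \<kappa> \<subseteq> (\<Union>u\<in>{u \<in> sign_vectors d. u g = 1}. lissajous d n \<kappa> u ` {0..<2 * pi})"
  proof
    fix x assume "x \<in> cheb_variety d n \<kappa>"
    then obtain u t where u: "u \<in> sign_vectors d" and t: "t \<in> {0..<pi}" and x: "x = lissajous d n \<kappa> u t"
      using cheb_variety_eq_lissajous[OF assms(1-3)] by blast
    show "x \<in> (\<Union>u\<in>{u \<in> sign_vectors d. u g = 1}. lissajous d n \<kappa> u ` {0..<2 * pi})"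
    proof (cases "u g = 1")
      case True
      moreover have "t \<in> {0..<2 * pi}" using t by auto
      ultimately show ?thesis using u x by blast
    next
      case False
      \<comment> \<open>The factor \<open>-1\<close> in the exponent is there because
        \<open>t\<close> is \<open>t + pi\<close> shifted back by \<open>pi\<close>. At
        \<open>g\<close> the exponent is odd, so the sign flips to 1.\<close>
      define v where "v = (\<lambda>i\<in>{1..d}. u i * (-1) powi (int (prod_except d n i) * (-1)))"
      have "odd (prod_except d n g)"
        using odd_n by (auto simp: prod_except_def even_prod_iff)
      moreover have "u g = -1" using u g False by (auto simp: sign_vectors_def PiE_iff)
      ultimately have "v g = 1" using g by (simp add: v_def power_int_minus_left)
      moreover have "x = lissajous d n \<kappa> v (t + pi)"
        unfolding v_def x lissajous_shift[symmetric] by simp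
      moreover have "v \<in> sign_vectors d" unfolding v_def by (rule sign_vectors_shift[OF u])
      moreover have "t + pi \<in> {0..<2 * pi}" using t by auto
      ultimately show ?thesis by blast
    qed
  qed
qed (use lissajous_in_cheb_variety[OF n] in blast)

section \<open>Node points and singular points\<close>

text \<open>A cosine is \<plusminus>1 exactly at the multiples of \<open>pi\<close>, and the parity
  of the multiple decides the sign.\<close>

lemma signed_T_eq_sign_iff:
  "signed_T n \<kappa> i (cos \<theta>) = (-1) ^ r
    \<longleftrightarrow> (\<exists>k::int. 2 * real (n i) * \<theta> = of_int k * pi \<and> [k = \<kappa> i + int r] (mod 2))"
proof
  assume "signed_T n \<kappa> i (cos \<theta>) = (-1) ^ r"
  then have "cos (2 * real (n i) * \<theta> + of_int (\<kappa> i) * pi) = cos (of_int (int r) * pi)"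
    using cos_add_int_pi[of 0 "int r"] by (simp add: signed_T_cos)
  then obtain k :: int where
    "2 * real (n i) * \<theta> + of_int (\<kappa> i) * pi = of_int (int r) * pi + 2 * pi * of_int k \<or>
     - (2 * real (n i) * \<theta> + of_int (\<kappa> i) * pi) = of_int (int r) * pi + 2 * pi * of_int k"
    using cos_eq_cosD by blast
  then have "2 * real (n i) * \<theta> = of_int (int r - \<kappa> i + 2 * k) * pi \<or>
     2 * real (n i) * \<theta> = of_int (- int r - \<kappa> i - 2 * k) * pi"
    by (auto simp: algebra_simps)
  \<comment> \<open>Negation keeps parity, so both cases lead to the same congruence.\<close>
  moreover have "[int r - \<kappa> i + 2 * k = \<kappa> i + int r] (mod 2)" "[- int r - \<kappa> i - 2 * k = \<kappa> i + int r] (mod 2)"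
    by (auto simp: cong_iff_dvd_diff)
  ultimately show "\<exists>k::int. 2 * real (n i) * \<theta> = of_int k * pi \<and> [k = \<kappa> i + int r] (mod 2)"
    by blast
next
  assume "\<exists>k::int. 2 * real (n i) * \<theta> = of_int k * pi \<and> [k = \<kappa> i + int r] (mod 2)"
  then obtain k :: int where k: "2 * real (n i) * \<theta> = of_int k * pi" "[k = \<kappa> i + int r] (mod 2)"
    by blast
  then have "even (k + \<kappa> i) \<longleftrightarrow> even r"
    by (auto simp: cong_iff_dvd_diff)
  moreover have "signed_T n \<kappa> i (cos \<theta>) = (-1) powi (k + \<kappa> i)"
    using cos_add_int_pi[of 0 "k + \<kappa> i"] by (simp add: signed_T_cos k(1) distrib_right)
  ultimately show "signed_T n \<kappa> i (cos \<theta>) = (-1) ^ r"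
    by (auto simp: power_int_minus_left)
qed

lemma cos_interior_iff:
  assumes "0 \<le> \<theta>" "\<theta> \<le> pi"
  shows "cos \<theta> \<in> {-1<..<1} \<longleftrightarrow> 0 < \<theta> \<and> \<theta> < pi"
proof
  assume "cos \<theta> \<in> {-1<..<1}"
  then have "\<theta> \<noteq> 0" "\<theta> \<noteq> pi" by auto
  with assms show "0 < \<theta> \<and> \<theta> < pi" by auto
next
  assume "0 < \<theta> \<and> \<theta> < pi"
  then show "cos \<theta> \<in> {-1<..<1}"
    using cos_monotone_0_pi[of 0 \<theta>] cos_monotone_0_pi[of \<theta> pi] by simp
qed

text \<open>On the cube, a coordinate outside the open interval is \<plusminus>1, so the two
  implications merge into an equivalence of the same shape as in \<open>LC_index_on\<close>.\<close>

lemma face_iff: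
  "x \<in> face d M \<longleftrightarrow> x \<in> cube d \<and> (\<forall>i\<in>{1..d}. x i \<in> {-1<..<1} \<longleftrightarrow> i \<in> M)"
proof -
  have "((i \<in> M \<longrightarrow> x i \<in> {-1<..<1}) \<and> (i \<notin> M \<longrightarrow> x i \<in> {-1, 1})) \<longleftrightarrow> (x i \<in> {-1<..<1} \<longleftrightarrow> i \<in> M)"
    if "x \<in> cube d" "i \<in> {1..d}" for i
  proof -
    have "x i \<in> {-1..1}" using that unfolding cube_def by blast
    then show ?thesis by auto
  qed
  then show ?thesis unfolding face_def by blast
qed

lemma index_angle_iffs:
  assumes "(m::nat) > 0"
  shows "real k * pi / (2 * real m) \<le> pi \<longleftrightarrow> k \<le> 2 * m"
    and "real k * pi / (2 * real m) < pi \<longleftrightarrow> k < 2 * m"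
    and "0 < real k * pi / (2 * real m) \<longleftrightarrow> 0 < k"
proof -
  have "real k * pi / (2 * real m) \<le> pi \<longleftrightarrow> real k * pi \<le> real (2 * m) * pi"
    "real k * pi / (2 * real m) < pi \<longleftrightarrow> real k * pi < real (2 * m) * pi"
    using assms by (simp_all add: pos_divide_le_eq pos_divide_less_eq mult.commute)
  then show "real k * pi / (2 * real m) \<le> pi \<longleftrightarrow> k \<le> 2 * m"
    "real k * pi / (2 * real m) < pi \<longleftrightarrow> k < 2 * m"
    by (simp_all only: mult_le_cancel_right_pos[OF pi_gt_zero] mult_less_cancel_right_pos[OF pi_gt_zero]
        of_nat_le_iff of_nat_less_iff)
  show "0 < real k * pi / (2 * real m) \<longleftrightarrow> 0 < k"
    using assms by (simp add: zero_less_divide_iff zero_less_mult_iff)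
qed

text \<open>The angle \<open>k j * pi / (2 * n j)\<close> translates indices into coordinates:
  strict bounds on \<open>k j\<close> correspond to interior coordinates, the parity of
  \<open>k j\<close> to the value of the signed polynomial.\<close>

lemma LC_parity_eq:
  assumes n: "\<forall>i\<in>{1..d}. n i \<ge> 1"
  shows "LC_parity d n \<kappa> M r = {x \<in> face d M. \<forall>i\<in>{1..d}. signed_T n \<kappa> i (x i) = (-1) ^ r}"
proof (intro equalityI subsetI)
  fix x assume "x \<in> LC_parity d n \<kappa> M r"
  then obtain k where k: "k \<in> LC_index_on d n \<kappa> M r" and x: "x = LC_point d n k"
    by (auto simp: LC_parity_def)
  define \<theta> where "\<theta> j = real (k j) * pi / (2 * real (n j))" for j
  have xj: "x j = cos (\<theta> j)" if "j \<in> {1..d}" for j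
    using that by (simp add: x LC_point_def \<theta>_def)
  have coord: "(x j \<in> {-1<..<1} \<longleftrightarrow> j \<in> M) \<and> signed_T n \<kappa> j (x j) = (-1) ^ r"
    if j: "j \<in> {1..d}" for j
  proof -
    have n_pos: "n j > 0" using n j by force
    have le: "k j \<le> 2 * n j" and cong: "[int (k j) = \<kappa> j + int r] (mod 2)"
      and M: "(0 < k j \<and> k j < 2 * n j) \<longleftrightarrow> j \<in> M"
      using k j by (auto simp: LC_index_on_def LC_index_def)
    have eq: "2 * real (n j) * \<theta> j = of_int (int (k j)) * pi"
      using n_pos by (simp add: \<theta>_def)
    have "0 \<le> \<theta> j" by (simp add: \<theta>_def)
    moreover have "\<theta> j \<le> pi" "\<theta> j < pi \<longleftrightarrow> k j < 2 * n j" "0 < \<theta> j \<longleftrightarrow> 0 < k j"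
      using index_angle_iffs[OF n_pos, of "k j"] le by (simp_all add: \<theta>_def)
    ultimately have "x j \<in> {-1<..<1} \<longleftrightarrow> j \<in> M"
      using cos_interior_iff[of "\<theta> j"] M unfolding xj[OF j] by metis
    moreover have "signed_T n \<kappa> j (x j) = (-1) ^ r"
      unfolding xj[OF j] signed_T_eq_sign_iff using eq cong by blast
    ultimately show ?thesis by blast
  qed
  moreover have "x \<in> cube d" by (auto simp: x LC_point_def cube_def)
  ultimately show "x \<in> {x \<in> face d M. \<forall>i\<in>{1..d}. signed_T n \<kappa> i (x i) = (-1) ^ r}"
    by (simp add: face_iff)
next
  fix x assume "x \<in> {x \<in> face d M. \<forall>i\<in>{1..d}. signed_T n \<kappa> i (x i) = (-1) ^ r}"
  then have x_cube: "x \<in> cube d" and M: "\<And>i. i \<in> {1..d} \<Longrightarrow> x i \<in> {-1<..<1} \<longleftrightarrow> i \<in> M"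
    and T: "\<And>i. i \<in> {1..d} \<Longrightarrow> signed_T n \<kappa> i (x i) = (-1) ^ r"
    by (auto simp: face_iff)
  have "\<exists>k. k \<le> 2 * n j \<and> [int k = \<kappa> j + int r] (mod 2) \<and> ((0 < k \<and> k < 2 * n j) \<longleftrightarrow> j \<in> M)
      \<and> x j = cos (real k * pi / (2 * real (n j)))" if j: "j \<in> {1..d}" for j
  proof -
    have n_pos: "n j > 0" using n j by force
    have xj: "x j \<in> {-1..1}" using x_cube j by (auto simp: cube_def PiE_iff)
    \<comment> \<open>\<open>arccos\<close> picks the angle in \<open>{0..pi}\<close>, which forces
      the multiple found below to lie between 0 and \<open>2 * n j\<close>.\<close>
    define \<theta> where "\<theta> = arccos (x j)"
    have \<theta>: "cos \<theta> = x j" "0 \<le> \<theta>" "\<theta> \<le> pi"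
      using xj arccos_bounded[of "x j"] by (auto simp: \<theta>_def)
    obtain k' :: int where k': "2 * real (n j) * \<theta> = of_int k' * pi" "[k' = \<kappa> j + int r] (mod 2)"
      using T[OF j] unfolding \<theta>(1)[symmetric] signed_T_eq_sign_iff by blast
    have "0 \<le> of_int k' * pi" unfolding k'(1)[symmetric] using \<theta>(2) by simp
    then have "k' \<ge> 0" using pi_gt_zero by (simp add: zero_le_mult_iff not_le)
    then obtain k where k: "k' = int k" by (metis nonneg_int_cases)
    have eq: "\<theta> = real k * pi / (2 * real (n j))"
      using k'(1) n_pos k by (simp add: field_simps)
    have "k \<le> 2 * n j" "\<theta> < pi \<longleftrightarrow> k < 2 * n j" "0 < \<theta> \<longleftrightarrow> 0 < k"
      using index_angle_iffs[OF n_pos, of k] \<theta>(3) unfolding eq by simp_all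
    then show ?thesis
      using M[OF j] cos_interior_iff[OF \<theta>(2,3)] \<theta>(1) eq k k'(2) by (intro exI[of _ k]) auto
  qed
  then obtain k where k: "\<And>j. j \<in> {1..d} \<Longrightarrow> k j \<le> 2 * n j \<and> [int (k j) = \<kappa> j + int r] (mod 2) \<and>
      ((0 < k j \<and> k j < 2 * n j) \<longleftrightarrow> j \<in> M) \<and> x j = cos (real (k j) * pi / (2 * real (n j)))"
    by metis
  then have "restrict k {1..d} \<in> LC_index_on d n \<kappa> M r"
    by (auto simp: LC_index_on_def LC_index_def)
  moreover have "x = LC_point d n (restrict k {1..d})"
  proof
    fix j
    show "x j = LC_point d n (restrict k {1..d}) j"
      using k x_cube by (cases "j \<in> {1..d}") (auto simp: LC_point_def cube_def PiE_iff extensional_def)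
  qed
  ultimately show "x \<in> LC_parity d n \<kappa> M r" by (auto simp: LC_parity_def)
qed

section \<open>Jacobian and singular points\<close>

lemma partial_deriv_variety_eq:
  assumes "x j \<in> {-1..1}"
  shows "partial_deriv (variety_eq n \<kappa> i) j x =
    (if j = i then signed_T_slope n \<kappa> j (x j) else if j = Suc i then - signed_T_slope n \<kappa> j (x j) else 0)"
    (is "_ = ?D")
proof -
  have "((\<lambda>t. variety_eq n \<kappa> i (x(j := t))) has_vector_derivative ?D) (at (x j) within {-1..1})"
    using has_vector_derivative_diff_const[THEN iffD2, OF has_vector_derivative_signed_T[OF assms, of n \<kappa> j]]
      has_vector_derivative_diff[OF has_vector_derivative_const has_vector_derivative_signed_T[OF assms, of n \<kappa> j]]
    by (cases "j = i"; cases "j = Suc i") (simp_all add: variety_eq_def)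
  \<comment> \<open>A derivative within a nondegenerate closed interval is unique, also at its
    endpoints.\<close>
  then show ?thesis
    unfolding partial_deriv_def
    by (rule vector_derivative_within_closed_interval[rotated 2]) (use assms in auto)
qed

lemma singular_point_iff:
  assumes n: "\<forall>i\<in>{1..d}. n i \<ge> 1" and x: "x \<in> cheb_variety d n \<kappa>"
  shows "singular_point d n \<kappa> x \<longleftrightarrow>
    (\<exists>p\<in>{1..d}. \<exists>q\<in>{1..d}. p < q \<and> x p \<in> {-1<..<1} \<and> x q \<in> {-1<..<1} \<and>
      \<bar>signed_T n \<kappa> p (x p)\<bar> = 1 \<and> \<bar>signed_T n \<kappa> q (x q)\<bar> = 1)"
proof -
  \<comment> \<open>Matrix columns count from 0, coordinates from 1.\<close>
  define a where "a j = signed_T_slope n \<kappa> (Suc j) (x (Suc j))" for j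
  have xj: "x j \<in> {-1..1}" if "j \<in> {1..d}" for j
    using x that by (auto simp: cheb_variety_def cube_def PiE_iff)
  have a0: "a j = 0 \<longleftrightarrow> x (Suc j) \<in> {-1<..<1} \<and> \<bar>signed_T n \<kappa> (Suc j) (x (Suc j))\<bar> = 1" if "j < d" for j
    unfolding a_def using n that by (intro signed_T_slope_eq_0_iff xj) auto
  have J: "jacobian d n \<kappa> x = mat (d - 1) d (\<lambda>(i, j). if j = i then a j else if j = Suc i then - a j else 0)"
    unfolding jacobian_def
  proof (rule cong_mat, goal_cases)
    case (3 i j)
    then have "Suc j \<in> {1..d}" by simp
    from xj[OF this] have "partial_deriv (variety_eq n \<kappa> (Suc i)) (Suc j) x = (if j = i then a j else if j = Suc i then - a j else 0)"
      by (simp add: partial_deriv_variety_eq a_def)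
    with 3 show ?case by simp
  qed simp_all
  have "singular_point d n \<kappa> x \<longleftrightarrow> (\<exists>p q. p < q \<and> q < d \<and> a p = 0 \<and> a q = 0)"
    using x rank_bidiagonal[of d a] by (simp add: singular_point_def J)
  also have "\<dots> \<longleftrightarrow> (\<exists>p\<in>{1..d}. \<exists>q\<in>{1..d}. p < q \<and> x p \<in> {-1<..<1} \<and> x q \<in> {-1<..<1} \<and>
      \<bar>signed_T n \<kappa> p (x p)\<bar> = 1 \<and> \<bar>signed_T n \<kappa> q (x q)\<bar> = 1)" (is "?L \<longleftrightarrow> ?R")
  proof
    assume ?L
    then obtain p q where "p < q" "q < d" "a p = 0" "a q = 0" by blast
    then show ?R
      using a0 by (intro bexI[of _ "Suc p"] bexI[of _ "Suc q"]) auto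
  next
    assume ?R
    then obtain p' q' where pq': "p' \<in> {1..d}" "q' \<in> {1..d}" "p' < q'"
      "x p' \<in> {-1<..<1}" "x q' \<in> {-1<..<1}"
      "\<bar>signed_T n \<kappa> p' (x p')\<bar> = 1" "\<bar>signed_T n \<kappa> q' (x q')\<bar> = 1"
      by blast
    obtain p q where Suc: "p' = Suc p" "q' = Suc q"
      using pq'(1,2) by (cases p'; cases q') auto
    then have "p < q" "p < d" "q < d" using pq'(1-3) by auto
    moreover have "a p = 0" "a q = 0"
      using a0 \<open>p < d\<close> \<open>q < d\<close> pq' unfolding Suc by blast+
    ultimately show ?L by blast
  qed
  finally show ?thesis .
qed

text \<open>On the variety all signed values coincide, so a value \<plusminus>1 in one coordinate
  settles the parity for all of them; the slopes then vanish exactly at the interior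
  coordinates.\<close>

lemma singular_point_iff_LC:
  assumes n: "\<forall>i\<in>{1..d}. n i \<ge> 1" and x: "x \<in> cheb_variety d n \<kappa>"
  shows "singular_point d n \<kappa> x \<longleftrightarrow> (\<exists>M\<subseteq>{1..d}. card M \<ge> 2 \<and> x \<in> LC d n \<kappa> M)"
proof -
  have LC_iff: "x \<in> LC d n \<kappa> M \<longleftrightarrow> x \<in> face d M \<and>
      ((\<forall>i\<in>{1..d}. signed_T n \<kappa> i (x i) = 1) \<or> (\<forall>i\<in>{1..d}. signed_T n \<kappa> i (x i) = -1))" for M
    by (auto simp: LC_def LC_parity_eq[OF n])
  have eq: "signed_T n \<kappa> i (x i) = signed_T n \<kappa> j (x j)" if "i \<in> {1..d}" "j \<in> {1..d}" for i j
    using x that unfolding cheb_variety_def by blast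
  show ?thesis
  proof
    assume "singular_point d n \<kappa> x"
    then obtain p q where pq: "p \<in> {1..d}" "q \<in> {1..d}" "p < q" "x p \<in> {-1<..<1}" "x q \<in> {-1<..<1}"
      "\<bar>signed_T n \<kappa> p (x p)\<bar> = 1"
      unfolding singular_point_iff[OF assms] by blast
    \<comment> \<open>The only subset of \<open>{1..d}\<close> whose face contains
      \<open>x\<close>.\<close>
    define M where "M = {i \<in> {1..d}. x i \<in> {-1<..<1}}"
    have "card {p, q} \<le> card M" using pq by (intro card_mono) (auto simp: M_def)
    then have "card M \<ge> 2" using pq by simp
    moreover have "x \<in> face d M" using x by (auto simp: face_iff M_def cheb_variety_def)
    moreover have "signed_T n \<kappa> p (x p) = 1 \<or> signed_T n \<kappa> p (x p) = -1" using pq by linarith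
    then have "(\<forall>i\<in>{1..d}. signed_T n \<kappa> i (x i) = 1) \<or> (\<forall>i\<in>{1..d}. signed_T n \<kappa> i (x i) = -1)"
      using eq[OF _ pq(1)] by metis
    moreover have "M \<subseteq> {1..d}" by (auto simp: M_def)
    ultimately show "\<exists>M\<subseteq>{1..d}. card M \<ge> 2 \<and> x \<in> LC d n \<kappa> M"
      unfolding LC_iff by blast
  next
    assume "\<exists>M\<subseteq>{1..d}. card M \<ge> 2 \<and> x \<in> LC d n \<kappa> M"
    then obtain M where M: "M \<subseteq> {1..d}" "card M \<ge> 2" and face: "x \<in> face d M"
      and T: "\<And>i. i \<in> {1..d} \<Longrightarrow> \<bar>signed_T n \<kappa> i (x i)\<bar> = 1"
      unfolding LC_iff by fastforce
    obtain p q where "p \<in> M" "q \<in> M" "p < q"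
    proof -
      obtain p q where "p \<in> M" "q \<in> M" "p \<noteq> q"
        using M(2) by (metis card_2_iff' obtain_subset_with_card_n subsetD)
      then show ?thesis using that by (metis linorder_neqE_nat)
    qed
    then show "singular_point d n \<kappa> x"
      unfolding singular_point_iff[OF assms] using M face T by (auto simp: face_iff)
  qed
qed

theorem theorem3p5:
  fixes d g :: nat and n :: "nat \<Rightarrow> nat" and \<kappa> :: "nat \<Rightarrow> int"
  assumes "d \<ge> 1"
    and "\<forall>i\<in>{1..d}. n i \<ge> 1"
    and "\<forall>i\<in>{1..d}. \<forall>j\<in>{1..d}. i \<noteq> j \<longrightarrow> coprime (n i) (n j)"
    and "g \<in> {1..d}"
    and "\<forall>i\<in>{1..d} - {g}. odd (n i)"
  shows "cheb_variety d n \<kappa> = (\<Union>u\<in>sign_vectors d. lissajous d n \<kappa> u ` {0..<pi})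
    \<and> cheb_variety d n \<kappa> =
        (\<Union>u\<in>{u \<in> sign_vectors d. u g = 1}. lissajous d n \<kappa> u ` {0..<2 * pi})
    \<and> (\<forall>x\<in>cheb_variety d n \<kappa>.
         singular_point d n \<kappa> x \<longleftrightarrow> (\<exists>M\<subseteq>{1..d}. card M \<ge> 2 \<and> x \<in> LC d n \<kappa> M))
    \<and> (\<forall>M\<subseteq>{1..d}. \<forall>r\<in>{0, 1}.
         LC_parity d n \<kappa> M r =
           {x \<in> face d M. \<forall>i\<in>{1..d}. signed_T n \<kappa> i (x i) = (-1) ^ r})"
  using cheb_variety_eq_lissajous[OF assms(1-3)] cheb_variety_eq_lissajous_half[OF assms]
    singular_point_iff_LC[OF assms(2)] LC_parity_eq[OF assms(2)]
  by (intro conjI ballI allI impI)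

end
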